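(* Let $K^r_n$ be the complete $r$-uniform hypergraph on $n$ vertices (with $n \ge 2s$). For $1 \leq s \leq r/2$, the eigenvalues of the $s$-th Laplacian $\mathcal{L}^{(s)}$ of $K^r_n$ are $$1- \frac{(-1)^{i}\binom{n-s-i}{s-i}}{\binom{n-s}{s}} \quad\text{with multiplicity } \binom{n}{i}-\binom{n}{i-1}, \qquad 0\leq i \leq s$$ (with the convention $\binom{n}{-1}=0$).
   Context: Let $H=(V,E)$ be an $r$-uniform hypergraph and $1\le s\le r/2$. For $S\subseteq V$, $d_S$ denotes the number of edges of $H$ containing $S$. The auxiliary weighted graph $G^{(s)}$ has vertex set $\binom{V}{s}$ (all $s$-subsets of $V$) and weight $w(S,T)=d_{S\cup T}$ if $S\cap T=\emptyset$ and $w(S,T)=0$ otherwise. Let $W=(w(S,T))$ be the weight matrix, $D$ the diagonal matrix with $D(S,S)=d_S$, and $T=\binom{r-s}{s}D$ (the diagonal matrix of degrees of $G^{(s)}$). The $s$-th Laplacian of $H$ is the normalized Laplacian $\mathcal{L}^{(s)}=I-T^{-1/2}WT^{-1/2}$ of $G^{(s)}$. *)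

theory Defs
  imports
    "HOL-Library.Ramsey"
    "HOL-Computational_Algebra.Polynomial"
    "Jordan_Normal_Form.Char_Poly"
begin

text \<open>
  A hypergraph is given by its edge set \<open>E\<close>. Matrices over the \<open>s\<close>-subsets of the vertex set are
  indexed through an enumeration \<open>xs\<close> of these subsets: row (column) \<open>i\<close> belongs to the set
  \<open>xs ! i\<close>.
\<close>

definition set_degree :: "'a set set \<Rightarrow> 'a set \<Rightarrow> nat" where
  "set_degree E S = card {e \<in> E. S \<subseteq> e}"

definition set_weight :: "'a set set \<Rightarrow> 'a set \<Rightarrow> 'a set \<Rightarrow> nat" where
  "set_weight E S U = (if S \<inter> U = {} then set_degree E (S \<union> U) else 0)"

definition weight_mat :: "'a set set \<Rightarrow> 'a set list \<Rightarrow> real mat" where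
  "weight_mat E xs =
     mat (length xs) (length xs) (\<lambda>(i, j). real (set_weight E (xs ! i) (xs ! j)))"

definition set_degree_mat :: "'a set set \<Rightarrow> 'a set list \<Rightarrow> real mat" where
  "set_degree_mat E xs = mat_diag (length xs) (\<lambda>i. real (set_degree E (xs ! i)))"

definition aux_degree_mat :: "nat \<Rightarrow> nat \<Rightarrow> 'a set set \<Rightarrow> 'a set list \<Rightarrow> real mat" where
  "aux_degree_mat r s E xs = real ((r - s) choose s) \<cdot>\<^sub>m set_degree_mat E xs"

text \<open>
  The power \<open>A\<^sup>-\<^sup>1\<^sup>/\<^sup>2\<close> of a diagonal matrix; meaningful only if all diagonal entries are positive.
\<close>

definition diag_inv_sqrt :: "real mat \<Rightarrow> real mat" where
  "diag_inv_sqrt A = mat_diag (dim_row A) (\<lambda>i. 1 / sqrt (A $$ (i, i)))"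

definition hypergraph_laplacian :: "nat \<Rightarrow> nat \<Rightarrow> 'a set set \<Rightarrow> 'a set list \<Rightarrow> real mat" where
  "hypergraph_laplacian r s E xs =
     1\<^sub>m (length xs)
     - diag_inv_sqrt (aux_degree_mat r s E xs) * weight_mat E xs
         * diag_inv_sqrt (aux_degree_mat r s E xs)"

definition complete_hypergraph_edges :: "nat \<Rightarrow> 'a set \<Rightarrow> 'a set set" where
  "complete_hypergraph_edges r V = nsets V r"

text \<open>
  Eigenvalues counted with algebraic multiplicity. Only real eigenvalues are collected, which
  loses nothing for the symmetric matrices considered here; for these the algebraic and the
  geometric multiplicities agree as well.
\<close>

definition eigenvalues_mset :: "real mat \<Rightarrow> real multiset" where
  "eigenvalues_mset A = proots (char_poly A)"

text \<open>
  \<open>binomial n (i - 1)\<close> with the convention that it vanishes for \<open>i = 0\<close>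
  (truncated subtraction on \<open>nat\<close> would give \<open>binomial n 0 = 1\<close>).
\<close>

definition binomial_pred :: "nat \<Rightarrow> nat \<Rightarrow> nat" where
  "binomial_pred n i = (if i = 0 then 0 else n choose (i - 1))"

end

theory Submission
  imports Defs
begin

text \<open>
  For a coefficient sequence \<open>a\<close> let \<open>M\<^sub>t(a)\<close> be the matrix over the \<open>t\<close>-subsets of \<open>V\<close> whose
  \<open>(S, U)\<close> entry is \<open>\<Sum>j\<le>t. a\<^sub>j * binomial |S \<inter> U| j\<close>. By inclusion-exclusion the Laplacian of the
  complete hypergraph is \<open>M\<^sub>s(a)\<close> with \<open>a\<^sub>j = [j = s] - (-1)\<^sup>j / binomial (n - s) s\<close>.

  Subtracting \<open>a\<^sub>t\<close> from the diagonal, \<open>M\<^sub>t(a) - a\<^sub>t I\<close> factors as \<open>U X\<close>, where \<open>U\<close> is the inclusion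
  matrix between \<open>t\<close>-subsets and \<open>(t-1)\<close>-subsets, and \<open>X U = M\<^sub>t\<^sub>-\<^sub>1(b) - a\<^sub>t I\<close> for an explicit \<open>b\<close>.
  Since \<open>U X\<close> and \<open>X U\<close> have the same characteristic polynomial up to a power of the variable, passing
  from level \<open>t\<close> to level \<open>t - 1\<close> splits off the eigenvalue \<open>a\<^sub>t\<close> with multiplicity
  \<open>binomial n t - binomial n (t - 1)\<close>, and solving the recursion for the coefficients gives the
  spectrum. This counts multiplicities correctly also for \<open>n = 2s\<close>, where
  eigenvalues for different \<open>i\<close> coincide.
\<close>

section \<open>Characteristic polynomials of block matrices and of swapped products\<close>

lemma char_poly_four_block_upper_right_zero:
  fixes A :: "'a :: idom mat"
  assumes A: "A \<in> carrier_mat m m" and C: "C \<in> carrier_mat n m" and D: "D \<in> carrier_mat n n"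
  shows "char_poly (four_block_mat A (0\<^sub>m m n) C D) = char_poly A * char_poly D"
proof -
  have "char_poly_matrix (four_block_mat A (0\<^sub>m m n) C D) =
    four_block_mat (char_poly_matrix A) (0\<^sub>m m n) (map_mat (\<lambda>a. [:- a:]) C) (char_poly_matrix D)"
    unfolding char_poly_matrix_def
    by (rule eq_matI, insert A C D, auto simp: one_poly_def)
  then show ?thesis
    unfolding char_poly_def using A C D
    by (simp add: det_four_block_mat_upper_right_zero[where n = m and m = n])
qed

lemma char_poly_scalar_mat:
  fixes c :: "'a :: comm_ring_1"
  shows "char_poly (c \<cdot>\<^sub>m 1\<^sub>m n) = [:- c, 1:] ^ n"
proof -
  have "diag_mat (c \<cdot>\<^sub>m 1\<^sub>m n :: 'a mat) = replicate n c"
    by (rule nth_equalityI) (auto simp: diag_mat_def)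
  then show ?thesis
    by (subst char_poly_upper_triangular[where n = n]) (auto simp: upper_triangular_def)
qed

lemma uminus_zero_mat: "- 0\<^sub>m m n = (0\<^sub>m m n :: 'a :: group_add mat)"
  by (rule eq_matI) auto

text \<open>
  The block matrices with rows \<open>(AB + c, 0)\<close>, \<open>(B, c)\<close> and \<open>(c, 0)\<close>, \<open>(B, BA + c)\<close> are conjugate
  under the matrix with rows \<open>(1, A)\<close>, \<open>(0, 1)\<close>.
\<close>

lemma char_poly_mult_swap_shift:
  fixes A :: "'a :: idom mat"
  assumes A: "A \<in> carrier_mat m n" and B: "B \<in> carrier_mat n m"
  shows "char_poly (A * B + c \<cdot>\<^sub>m 1\<^sub>m m) * [:- c, 1:] ^ n =
         [:- c, 1:] ^ m * char_poly (B * A + c \<cdot>\<^sub>m 1\<^sub>m n)"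
proof -
  let ?M = "four_block_mat (A * B + c \<cdot>\<^sub>m 1\<^sub>m m) (0\<^sub>m m n) B (c \<cdot>\<^sub>m 1\<^sub>m n)"
  let ?N = "four_block_mat (c \<cdot>\<^sub>m 1\<^sub>m m) (0\<^sub>m m n) B (B * A + c \<cdot>\<^sub>m 1\<^sub>m n)"
  let ?P = "four_block_mat (1\<^sub>m m) A (0\<^sub>m n m) (1\<^sub>m n)"
  let ?Q = "four_block_mat (1\<^sub>m m) (- A) (0\<^sub>m n m) (1\<^sub>m n)"
  have carr: "{?M, ?N, ?P, ?Q} \<subseteq> carrier_mat (m + n) (m + n)"
    using A B by auto
  have PQ: "?P * ?Q = 1\<^sub>m (m + n)"
    using A by (subst mult_four_block_mat[where ?nr1.0 = m and ?n1.0 = m and ?nr2.0 = n and ?n2.0 = n])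
      (auto simp: uminus_l_inv_mat uminus_zero_mat)
  have QP: "?Q * ?P = 1\<^sub>m (m + n)"
    using A by (subst mult_four_block_mat[where ?nr1.0 = m and ?n1.0 = m and ?nr2.0 = n and ?n2.0 = n])
      (auto simp: uminus_l_inv_mat[of A m n] comm_add_mat[of A m n "- A"] uminus_zero_mat)
  have "?P * ?N = ?M * ?P"
  proof -
    have "?P * ?N = four_block_mat (c \<cdot>\<^sub>m 1\<^sub>m m + A * B) (A * (B * A + c \<cdot>\<^sub>m 1\<^sub>m n)) B (B * A + c \<cdot>\<^sub>m 1\<^sub>m n)"
      using A B by (subst mult_four_block_mat[where ?nr1.0 = m and ?n1.0 = m and ?nr2.0 = n and ?n2.0 = n])
        auto
    moreover have "?M * ?P =
        four_block_mat (A * B + c \<cdot>\<^sub>m 1\<^sub>m m) ((A * B + c \<cdot>\<^sub>m 1\<^sub>m m) * A) B (B * A + c \<cdot>\<^sub>m 1\<^sub>m n)"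
      using A B by (subst mult_four_block_mat[where ?nr1.0 = m and ?n1.0 = m and ?nr2.0 = n and ?n2.0 = n])
        auto
    moreover have "A * (B * A + c \<cdot>\<^sub>m 1\<^sub>m n) = (A * B + c \<cdot>\<^sub>m 1\<^sub>m m) * A"
    proof -
      have "A * (B * A + c \<cdot>\<^sub>m 1\<^sub>m n) = A * (B * A) + c \<cdot>\<^sub>m A"
        using A B by (simp add: mult_add_distrib_mat[where nr = m and n = n and nc = n]
            mult_smult_distrib[where nr = m and n = n and nc = n])
      moreover have "(A * B + c \<cdot>\<^sub>m 1\<^sub>m m) * A = A * B * A + c \<cdot>\<^sub>m A"
        using A B by (simp add: add_mult_distrib_mat[where nr = m and n = m and nc = n]
            mult_smult_assoc_mat[where nr = m and n = m and nc = n])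
      ultimately show ?thesis
        using A B by simp
    qed
    moreover have "c \<cdot>\<^sub>m 1\<^sub>m m + A * B = A * B + c \<cdot>\<^sub>m 1\<^sub>m m"
      using A B by (intro comm_add_mat) auto
    ultimately show ?thesis by simp
  qed
  then have "?P * ?N * ?Q = ?M * (?P * ?Q)"
    using carr by (simp add: assoc_mult_mat[where ?n\<^sub>1 = "m + n" and ?n\<^sub>2 = "m + n" and ?n\<^sub>3 = "m + n" and ?n\<^sub>4 = "m + n"])
  then have "?M = ?P * ?N * ?Q"
    using carr unfolding PQ by simp
  then have "similar_mat ?M ?N"
    by (intro similar_matI[OF carr PQ QP])
  then have "char_poly ?M = char_poly ?N"
    by (rule char_poly_similar)
  \<comment> \<open>Both matrices are block lower triangular, so the scalar blocks split off as the
    powers of \<open>[:- c, 1:]\<close> with exponents \<open>n\<close> and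
    \<open>m\<close>.\<close>
  then show ?thesis
    using A B by (simp add: char_poly_four_block_upper_right_zero[where m = m and n = n]
        char_poly_scalar_mat)
qed

section \<open>Matrices indexed by enumerated families of sets\<close>

definition set_mat :: "'a set list \<Rightarrow> 'a set list \<Rightarrow> ('a set \<Rightarrow> 'a set \<Rightarrow> 'b) \<Rightarrow> 'b mat" where
  "set_mat xs ys f = mat (length xs) (length ys) (\<lambda>(i, j). f (xs ! i) (ys ! j))"

lemma set_mat_carrier [simp]: "set_mat xs ys f \<in> carrier_mat (length xs) (length ys)"
  by (simp add: set_mat_def)

lemma set_mat_cong:
  assumes "\<And>S U. S \<in> set xs \<Longrightarrow> U \<in> set ys \<Longrightarrow> f S U = g S U"
  shows "set_mat xs ys f = set_mat xs ys g"
  unfolding set_mat_def by (rule eq_matI) (auto intro!: assms)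

lemma set_mat_mult:
  assumes "distinct ys"
  shows "set_mat xs ys f * set_mat ys zs g =
    set_mat xs zs (\<lambda>S U. \<Sum>R\<in>set ys. f S R * (g R U :: 'b :: semiring_0))"
proof (rule eq_matI)
  fix i j
  assume "i < dim_row (set_mat xs zs (\<lambda>S U. \<Sum>R\<in>set ys. f S R * g R U))"
    and "j < dim_col (set_mat xs zs (\<lambda>S U. \<Sum>R\<in>set ys. f S R * g R U))"
  then have ij: "i < length xs" "j < length zs"
    by (auto simp: set_mat_def)
  have "(set_mat xs ys f * set_mat ys zs g) $$ (i, j) =
      (\<Sum>k<length ys. f (xs ! i) (ys ! k) * g (ys ! k) (zs ! j))"
    using ij by (simp add: set_mat_def scalar_prod_def atLeast0LessThan)
  also have "\<dots> = (\<Sum>R\<in>set ys. f (xs ! i) R * g R (zs ! j))"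
    by (rule sum.reindex_bij_betw) (rule bij_betw_nth[OF assms refl refl])
  finally show "(set_mat xs ys f * set_mat ys zs g) $$ (i, j) =
      set_mat xs zs (\<lambda>S U. \<Sum>R\<in>set ys. f S R * g R U) $$ (i, j)"
    using ij by (simp add: set_mat_def)
qed (auto simp: set_mat_def)

lemma set_mat_add_scalar:
  fixes c :: "'b :: semiring_1"
  assumes "distinct xs"
  shows "set_mat xs xs f + c \<cdot>\<^sub>m 1\<^sub>m (length xs) =
    set_mat xs xs (\<lambda>S U. f S U + c * of_bool (S = U))"
  unfolding set_mat_def by (rule eq_matI) (auto simp: nth_eq_iff_index_eq[OF assms])

lemma length_enum_nsets:
  assumes "finite V" "distinct xs" "set xs = nsets V t"
  shows "length xs = card V choose t"
  using assms by (metis card_nsets distinct_card)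

section \<open>Sums over subsets and supersets with one element less or more\<close>

text \<open>Distinct \<open>t\<close>-sets share fewer than \<open>t\<close> points. Hence the top
  coefficient \<open>a t\<close> contributes exactly the scalar matrix \<open>a t\<close> times the
  identity, which is what the factorization splits off.\<close>

lemma choose_card_Int_eq_of_bool:
  assumes "S \<in> nsets V t" "U \<in> nsets V t"
  shows "card (S \<inter> U) choose t = of_bool (S = U)"
proof (cases "S = U")
  case True
  then show ?thesis using assms by (auto simp: nsets_def)
next
  case False
  have S: "finite S" "card S = t" "finite U" "card U = t"
    using assms by (auto simp: nsets_def)
  have "card (S \<inter> U) \<le> t"
    using S by (metis card_mono inf_le1)
  moreover have "card (S \<inter> U) \<noteq> t"
    using S False by (metis card_subset_eq inf_le1 inf_le2)
  ultimately show ?thesis using False by simp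
qed

text \<open>A \<open>t\<close>-subset of a \<open>Suc t\<close>-set omits exactly one point. This
  turns left multiplication by the inclusion matrix into a sum over points.\<close>

lemma sum_nsets_subset:
  assumes S: "S \<in> nsets V (Suc t)" and V: "finite V"
  shows "(\<Sum>R\<in>nsets V t. of_bool (R \<subseteq> S) * h R) = (\<Sum>x\<in>S. h (S - {x}) :: 'b :: semiring_1)"
proof -
  have fS: "finite S" "card S = Suc t" "S \<subseteq> V"
    using S by (auto simp: nsets_def)
  have "(\<Sum>R\<in>nsets V t. of_bool (R \<subseteq> S) * h R) = (\<Sum>R\<in>{R \<in> nsets V t. R \<subseteq> S}. h R)"
    by (rule sum.mono_neutral_cong_right) (use V in \<open>auto simp: finite_imp_finite_nsets\<close>)
  also have "{R \<in> nsets V t. R \<subseteq> S} = (\<lambda>x. S - {x}) ` S"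
  proof (intro equalityI subsetI)
    fix R assume "R \<in> {R \<in> nsets V t. R \<subseteq> S}"
    then have R: "R \<subseteq> S" "finite R" "card R = t"
      by (auto simp: nsets_def)
    then have "card (S - R) = 1"
      using fS by (simp add: card_Diff_subset)
    then obtain x where "S - R = {x}"
      by (auto simp: card_1_singleton_iff)
    then have "R = S - {x}" "x \<in> S"
      using R by auto
    then show "R \<in> (\<lambda>x. S - {x}) ` S" by blast
  qed (use fS in \<open>auto simp: nsets_def\<close>)
  also have "(\<Sum>R\<in>(\<lambda>x. S - {x}) ` S. h R) = (\<Sum>x\<in>S. h (S - {x}))"
    by (subst sum.reindex) (auto simp: inj_on_def)
  finally show ?thesis .
qed

text \<open>The dual form, for right multiplication by the inclusion matrix: a superset with one
  more element is determined by the added point.\<close>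

lemma sum_nsets_superset:
  assumes R: "R \<in> nsets V t" and V: "finite V"
  shows "(\<Sum>S\<in>nsets V (Suc t). h S * of_bool (R \<subseteq> S)) = (\<Sum>x\<in>V - R. h (insert x R) :: 'b :: semiring_1)"
proof -
  have fR: "finite R" "card R = t" "R \<subseteq> V"
    using R by (auto simp: nsets_def)
  have "(\<Sum>S\<in>nsets V (Suc t). h S * of_bool (R \<subseteq> S)) = (\<Sum>S\<in>{S \<in> nsets V (Suc t). R \<subseteq> S}. h S)"
    by (rule sum.mono_neutral_cong_right) (use V in \<open>auto simp: finite_imp_finite_nsets\<close>)
  also have "{S \<in> nsets V (Suc t). R \<subseteq> S} = (\<lambda>x. insert x R) ` (V - R)"
  proof (intro equalityI subsetI)
    fix S assume "S \<in> {S \<in> nsets V (Suc t). R \<subseteq> S}"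
    then have S: "R \<subseteq> S" "finite S" "card S = Suc t" "S \<subseteq> V"
      by (auto simp: nsets_def)
    then have "card (S - R) = 1"
      using fR by (simp add: card_Diff_subset)
    then obtain x where "S - R = {x}"
      by (auto simp: card_1_singleton_iff)
    then have "S = insert x R" "x \<in> V - R"
      using S by auto
    then show "S \<in> (\<lambda>x. insert x R) ` (V - R)" by blast
  qed (use fR in \<open>auto simp: nsets_def\<close>)
  also have "(\<Sum>S\<in>(\<lambda>x. insert x R) ` (V - R). h S) = (\<Sum>x\<in>V - R. h (insert x R))"
    by (subst sum.reindex) (auto simp: inj_on_def)
  finally show ?thesis .
qed

section \<open>Effect of deleting or adding a point on binomials of the overlap size\<close>

lemma real_binomial_absorb_comp:
  "real k * real ((k - 1) choose j) = (real k - real j) * real (k choose j)"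
proof (cases "j \<le> k")
  case True
  then show ?thesis
    using arg_cong[OF binomial_absorb_comp[of k j], of real] by (simp add: of_nat_diff)
qed (auto simp: binomial_eq_0)

text \<open>Deleting one of the \<open>k\<close> points of \<open>S \<inter> U\<close> lowers the
  overlap by one; any other deletion preserves it. Absorption then merges both contributions into a
  multiple of the same binomial, so point deletion acts diagonally in the binomial basis.\<close>

lemma sum_choose_card_Diff_singleton:
  assumes "finite S"
  shows "(\<Sum>x\<in>S. real (card ((S - {x}) \<inter> U) choose j)) =
    (real (card S) - real j) * real (card (S \<inter> U) choose j)"
proof -
  let ?k = "card (S \<inter> U)"
  have "(\<Sum>x\<in>S. real (card ((S - {x}) \<inter> U) choose j)) =
      (\<Sum>x\<in>S \<inter> U. real (card ((S - {x}) \<inter> U) choose j)) +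
      (\<Sum>x\<in>S - U. real (card ((S - {x}) \<inter> U) choose j))"
    by (rule sum.Int_Diff[OF assms])
  also have "(\<Sum>x\<in>S \<inter> U. real (card ((S - {x}) \<inter> U) choose j)) =
      (\<Sum>x\<in>S \<inter> U. real ((?k - 1) choose j))"
  proof (intro sum.cong refl)
    fix x assume "x \<in> S \<inter> U"
    moreover have "(S - {x}) \<inter> U = S \<inter> U - {x}" by auto
    ultimately show "real (card ((S - {x}) \<inter> U) choose j) = real ((?k - 1) choose j)"
      by simp
  qed
  also have "(\<Sum>x\<in>S - U. real (card ((S - {x}) \<inter> U) choose j)) =
      (\<Sum>x\<in>S - U. real (?k choose j))"
  proof (intro sum.cong refl)
    fix x assume "x \<in> S - U"
    then have "(S - {x}) \<inter> U = S \<inter> U" by auto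
    then show "real (card ((S - {x}) \<inter> U) choose j) = real (?k choose j)"
      by simp
  qed
  also have "(\<Sum>x\<in>S \<inter> U. real ((?k - 1) choose j)) + (\<Sum>x\<in>S - U. real (?k choose j)) =
      real ?k * real ((?k - 1) choose j) + real (card (S - U)) * real (?k choose j)"
    by simp
  also have "real (card (S - U)) = real (card S) - real ?k"
    using assms by (metis add_diff_cancel_left' card_Int_Diff of_nat_add)
  finally show ?thesis
    unfolding real_binomial_absorb_comp by (simp add: algebra_simps)
qed

text \<open>With \<open>k\<close> the overlap of \<open>R\<close> and \<open>R'\<close>, the
  \<open>t - k\<close> points of \<open>R - R'\<close> raise it by one and the remaining
  \<open>n - 2t + k\<close> points leave it alone, where \<open>n = card V\<close>. Pascal's rule
  expands the raised binomial.\<close>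

lemma sum_choose_card_insert:
  assumes V: "finite V" and R: "R \<subseteq> V" "card R = t" and R': "R' \<subseteq> V" "card R' = t"
  shows "(\<Sum>x\<in>V - R'. real (card (R \<inter> insert x R') choose j)) =
    (real (card V) - real t - real j) * real (card (R \<inter> R') choose j) +
    (real t + 1 - real j) * real (binomial_pred (card (R \<inter> R')) j)"
proof -
  let ?k = "card (R \<inter> R')"
  have fin: "finite R" "finite R'"
    using assms finite_subset by blast+
  have card_R: "real (card (R - R')) = real t - real ?k"
    using fin R by (metis add_diff_cancel_left' card_Int_Diff of_nat_add)
  have card_V: "real (card (V - R' - R)) = real (card V) - 2 * real t + real ?k"
  proof -
    have "V - R' - R = (V - R') - (R - R')" by auto
    moreover have "R - R' \<subseteq> V - R'" using R by auto
    ultimately have "card (V - R' - R) + card (R - R') = card (V - R')"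
      using V fin by (metis card_Diff_subset card_mono finite_Diff le_add_diff_inverse2)
    moreover have "card (V - R') + t = card V"
      using V fin R' by (metis card_Diff_subset card_mono le_add_diff_inverse2)
    ultimately show ?thesis
      using card_R by linarith
  qed
  have "(\<Sum>x\<in>V - R'. real (card (R \<inter> insert x R') choose j)) =
      (\<Sum>x\<in>(V - R') \<inter> R. real (card (R \<inter> insert x R') choose j)) +
      (\<Sum>x\<in>V - R' - R. real (card (R \<inter> insert x R') choose j))"
    by (rule sum.Int_Diff) (use V in simp)
  also have "(\<Sum>x\<in>(V - R') \<inter> R. real (card (R \<inter> insert x R') choose j)) =
      (\<Sum>x\<in>(V - R') \<inter> R. real (Suc ?k choose j))"
  proof (intro sum.cong refl)
    fix x assume "x \<in> (V - R') \<inter> R"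
    then have "R \<inter> insert x R' = insert x (R \<inter> R')" "x \<notin> R \<inter> R'" by auto
    then show "real (card (R \<inter> insert x R') choose j) = real (Suc ?k choose j)"
      using fin by simp
  qed
  also have "(\<Sum>x\<in>V - R' - R. real (card (R \<inter> insert x R') choose j)) =
      (\<Sum>x\<in>V - R' - R. real (?k choose j))"
    by (intro sum.cong refl) auto
  also have "(V - R') \<inter> R = R - R'"
    using R by auto
  also have "(\<Sum>x\<in>R - R'. real (Suc ?k choose j)) + (\<Sum>x\<in>V - R' - R. real (?k choose j)) =
      (real t - real ?k) * real (Suc ?k choose j) +
      (real (card V) - 2 * real t + real ?k) * real (?k choose j)"
    using card_R card_V by simp
  also have "real (Suc ?k choose j) = real (?k choose j) + real (binomial_pred ?k j)"
    by (cases j) (auto simp: binomial_pred_def)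
  also have "(real t - real ?k) * (real (?k choose j) + real (binomial_pred ?k j)) +
      (real (card V) - 2 * real t + real ?k) * real (?k choose j) =
    (real (card V) - real t) * real (?k choose j) + (real t - real ?k) * real (binomial_pred ?k j)"
    by (simp add: algebra_simps)
  also have "\<dots> = (real (card V) - real t - real j) * real (?k choose j) +
    (real t + 1 - real j) * real (binomial_pred ?k j)"
  proof -
    \<comment> \<open>This identity trades the factor \<open>?k\<close> for constants, so that the
      coefficients depend only on \<open>card V\<close>, \<open>t\<close> and \<open>j\<close>. For
      \<open>j = 0\<close> both sides vanish by the convention in
      \<open>binomial_pred\<close>.\<close>
    have "real j * real (?k choose j) = (real ?k + 1 - real j) * real (binomial_pred ?k j)"
    proof (cases j)
      case (Suc i)
      have "real (Suc i) * real (?k choose Suc i) = real ?k * real ((?k - 1) choose i)"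
        by (metis binomial_absorption of_nat_mult)
      also have "\<dots> = (real ?k - real i) * real (?k choose i)"
        by (rule real_binomial_absorb_comp)
      finally show ?thesis
        by (simp add: binomial_pred_def Suc)
    qed (simp add: binomial_pred_def)
    then show ?thesis by (simp add: algebra_simps)
  qed
  finally show ?thesis .
qed

section \<open>The recursion from level \<open>Suc t\<close> to level \<open>t\<close>\<close>

text \<open>This is \<open>M_t(a)\<close>. When \<open>xs\<close> enumerates the
  \<open>t\<close>-subsets, these matrices form the Bose-Mesner algebra of the Johnson scheme, here
  in the basis of binomials of the overlap size.\<close>

definition overlap_mat :: "nat \<Rightarrow> (nat \<Rightarrow> real) \<Rightarrow> 'a set list \<Rightarrow> real mat" where
  "overlap_mat t a xs = set_mat xs xs (\<lambda>S U. \<Sum>j\<le>t. a j * real (card (S \<inter> U) choose j))"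

lemma char_poly_overlap_mat_Suc:
  fixes a :: "nat \<Rightarrow> real"
  assumes V: "finite V" and t: "2 * Suc t \<le> card V"
    and xs: "distinct xs" "set xs = nsets V (Suc t)"
    and ys: "distinct ys" "set ys = nsets V t"
    and b: "\<And>j. j \<le> t \<Longrightarrow>
      b j = a j * (real (card V) - real t - real j) / (real t + 1 - real j) + a (Suc j)"
  shows "char_poly (overlap_mat (Suc t) a xs) =
    [:- a (Suc t), 1:] ^ ((card V choose Suc t) - (card V choose t)) * char_poly (overlap_mat t b ys)"
proof -
  \<comment> \<open>The divisor \<open>t + 1 - j\<close>, positive for \<open>j \<le> t\<close>,
    cancels the factor produced by deleting points from a set of size \<open>Suc t\<close>.\<close>
  define f where "f R S = (\<Sum>j\<le>t. a j / (real t + 1 - real j) * real (card (R \<inter> S) choose j))"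
    for R S :: "'a set"
  let ?U = "set_mat xs ys (\<lambda>S R. of_bool (R \<subseteq> S) :: real)"
  let ?X = "set_mat ys xs f"
  let ?c = "a (Suc t)"
  have UX: "?U * ?X + ?c \<cdot>\<^sub>m 1\<^sub>m (length xs) = overlap_mat (Suc t) a xs"
    unfolding overlap_mat_def set_mat_mult[OF ys(1)] set_mat_add_scalar[OF xs(1)]
  proof (rule set_mat_cong)
    fix S T assume S: "S \<in> set xs" and T: "T \<in> set xs"
    have fS: "finite S" "card S = Suc t"
      using S xs by (auto simp: nsets_def)
    have "(\<Sum>R\<in>set ys. of_bool (R \<subseteq> S) * f R T) = (\<Sum>x\<in>S. f (S - {x}) T)"
      using sum_nsets_subset[of S V t "\<lambda>R. f R T"] S xs ys V by simp
    also have "\<dots> = (\<Sum>j\<le>t. a j / (real t + 1 - real j) *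
        (\<Sum>x\<in>S. real (card ((S - {x}) \<inter> T) choose j)))"
      unfolding f_def by (subst sum.swap) (simp add: sum_distrib_left)
    also have "\<dots> = (\<Sum>j\<le>t. a j * real (card (S \<inter> T) choose j))"
      by (intro sum.cong refl)
        (simp add: sum_choose_card_Diff_singleton[OF fS(1)] fS(2) field_simps)
    finally show "(\<Sum>R\<in>set ys. of_bool (R \<subseteq> S) * f R T) + ?c * of_bool (S = T) =
        (\<Sum>j\<le>Suc t. a j * real (card (S \<inter> T) choose j))"
      using choose_card_Int_eq_of_bool[of S V "Suc t" T] S T xs by simp
  qed
  have XU: "?X * ?U + ?c \<cdot>\<^sub>m 1\<^sub>m (length ys) = overlap_mat t b ys"
    unfolding overlap_mat_def set_mat_mult[OF xs(1)] set_mat_add_scalar[OF ys(1)]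
  proof (rule set_mat_cong)
    fix R R' assume R: "R \<in> set ys" and R': "R' \<in> set ys"
    let ?k = "card (R \<inter> R')"
    have "(\<Sum>S\<in>set xs. f R S * of_bool (R' \<subseteq> S)) = (\<Sum>x\<in>V - R'. f R (insert x R'))"
      using sum_nsets_superset[of R' V t "f R"] R' xs ys V by simp
    also have "\<dots> = (\<Sum>j\<le>t. a j / (real t + 1 - real j) *
        (\<Sum>x\<in>V - R'. real (card (R \<inter> insert x R') choose j)))"
      unfolding f_def by (subst sum.swap) (simp add: sum_distrib_left)
    also have "\<dots> = (\<Sum>j\<le>t. a j / (real t + 1 - real j) *
        ((real (card V) - real t - real j) * real (?k choose j) +
         (real t + 1 - real j) * real (binomial_pred ?k j)))"
      using R R' ys by (subst sum_choose_card_insert[OF V, where t = t]) (auto simp: nsets_def)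
    also have "\<dots> = (\<Sum>j\<le>t. a j * (real (card V) - real t - real j) / (real t + 1 - real j) *
        real (?k choose j)) + (\<Sum>j\<le>t. a j * real (binomial_pred ?k j))" (is "_ = ?A + ?B")
      unfolding sum.distrib[symmetric] by (intro sum.cong refl) (auto simp: field_simps)
    finally have "(\<Sum>S\<in>set xs. f R S * of_bool (R' \<subseteq> S)) + ?c * of_bool (R = R') =
        ?A + (?B + ?c * of_bool (R = R'))"
      by simp
    \<comment> \<open>On \<open>t\<close>-sets the indicator of \<open>R = R'\<close> is
      \<open>?k choose t\<close>, which is \<open>binomial_pred ?k (Suc t)\<close>: the scalar shift
      supplies the missing last term of \<open>?B\<close>. The term for \<open>j = 0\<close> is
      zero, so the index can then be shifted down.\<close>
    also have "?B + ?c * of_bool (R = R') = (\<Sum>j\<le>Suc t. a j * real (binomial_pred ?k j))"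
      using choose_card_Int_eq_of_bool[of R V t R'] R R' ys by (simp add: binomial_pred_def)
    also have "(\<Sum>j\<le>Suc t. a j * real (binomial_pred ?k j)) = (\<Sum>j\<le>t. a (Suc j) * real (?k choose j))"
      by (subst sum.atMost_Suc_shift) (simp add: binomial_pred_def)
    also have "?A + \<dots> = (\<Sum>j\<le>t. b j * real (?k choose j))"
      unfolding sum.distrib[symmetric] by (intro sum.cong refl) (simp add: b distrib_right)
    finally show "(\<Sum>S\<in>set xs. f R S * of_bool (R' \<subseteq> S)) + ?c * of_bool (R = R') =
      (\<Sum>j\<le>t. b j * real (?k choose j))" .
  qed
  let ?p = "[:- ?c, 1:] :: real poly"
  have len: "length xs = card V choose Suc t" "length ys = card V choose t"
    using length_enum_nsets V xs ys by blast+
  \<comment> \<open>Below the middle the binomials increase, so the truncated subtraction in the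
    multiplicity is a true difference.\<close>
  have le: "card V choose t \<le> card V choose Suc t"
    by (rule binomial_mono) (use t in auto)
  have "char_poly (overlap_mat (Suc t) a xs) * ?p ^ length ys =
      ?p ^ length xs * char_poly (overlap_mat t b ys)"
    using char_poly_mult_swap_shift[of ?U "length xs" "length ys" ?X ?c] UX XU by simp
  also have "?p ^ length xs = ?p ^ (length xs - length ys) * ?p ^ length ys"
    using le len by (simp flip: power_add)
  finally show ?thesis
    using len by simp
qed

section \<open>Solving the recursion for the coefficients\<close>

text \<open>Rewriting \<open>Suc u choose p\<close> through \<open>u choose p\<close> makes the left
  side \<open>(q choose p) / (u choose p)\<close> times \<open>(q + u + 2) / (u + 1) - 1\<close>.
  That factor is \<open>(q + 1) / (u + 1)\<close>, which raises both binomials on the right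
  side.\<close>

lemma binomial_quotient_recurrence:
  assumes "p \<le> u"
  shows "real (q choose p) / real (Suc u choose p) * (real q + real u + 2) / (real u + 1 - real p)
      - real (q choose p) / real (u choose p) =
    real (Suc q choose Suc p) / real (Suc u choose Suc p)"
proof -
  have pos: "real (u choose p) > 0" "real u + 1 - real p > 0"
    using assms by auto
  have 1: "real (Suc u choose p) = (real u + 1) * real (u choose p) / (real u + 1 - real p)"
    using real_binomial_absorb_comp[of "Suc u" p] pos by (simp add: field_simps)
  have 2: "real (Suc m choose Suc p) = (real m + 1) * real (m choose p) / (real p + 1)" for m
    using arg_cong[OF Suc_times_binomial[of p m], of real]
    by (simp add: field_simps del: binomial_Suc_Suc)
  show ?thesis
    unfolding 1 2 using pos by (simp add: divide_simps) (simp add: algebra_simps)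
qed

text \<open>
  Starting from \<open>[j = s] - \<kappa>(-1)\<^sup>j\<close> at \<open>t = s\<close>, these are the coefficients that the recursion of
  \<open>char_poly_overlap_mat_Suc\<close> produces at level \<open>t\<close>.
\<close>

definition level_coeff :: "nat \<Rightarrow> nat \<Rightarrow> real \<Rightarrow> nat \<Rightarrow> nat \<Rightarrow> real" where
  "level_coeff n s \<kappa> t j = of_bool (j = t) -
     \<kappa> * (- 1) ^ j * real ((n - s - t) choose (s - t)) / real ((s - j) choose (s - t))"

text \<open>The alternating sign turns the sum into the difference of
  \<open>binomial_quotient_recurrence\<close>. The indicator vanishes at \<open>j\<close>, since
  \<open>j < Suc t\<close>, and at \<open>Suc j\<close> it becomes that of
  \<open>j = t\<close>.\<close>

lemma level_coeff_Suc:
  assumes "t < s" "2 * s \<le> n" "j \<le> t"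
  shows "level_coeff n s \<kappa> t j =
    level_coeff n s \<kappa> (Suc t) j * (real n - real t - real j) / (real t + 1 - real j) +
    level_coeff n s \<kappa> (Suc t) (Suc j)"
proof -
  \<comment> \<open>One is subtracted in each so that the parameters at level \<open>t\<close> are
    successors, as the recurrence requires.\<close>
  define p q u where "p = s - Suc t" and "q = n - s - Suc t" and "u = s - Suc j"
  have *: "s - t = Suc p" "n - s - t = Suc q" "s - j = Suc u" "s - Suc t = p" "n - s - Suc t = q"
      "s - Suc j = u" "p \<le> u"
    using assms by (auto simp: p_def q_def u_def)
  have nt: "real n - real t - real j = real q + real u + 2" "real t + 1 - real j = real u + 1 - real p"
    using assms unfolding p_def q_def u_def by (auto simp: of_nat_diff)
  have "level_coeff n s \<kappa> (Suc t) j * (real n - real t - real j) / (real t + 1 - real j) +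
      level_coeff n s \<kappa> (Suc t) (Suc j) =
    of_bool (j = t) - \<kappa> * (- 1) ^ j *
      (real (q choose p) / real (Suc u choose p) * (real q + real u + 2) / (real u + 1 - real p)
      - real (q choose p) / real (u choose p))"
    unfolding level_coeff_def nt * using assms by (simp add: algebra_simps del: binomial_Suc_Suc)
  also have "\<dots> = level_coeff n s \<kappa> t j"
    unfolding binomial_quotient_recurrence[OF \<open>p \<le> u\<close>] level_coeff_def * by simp
  finally show ?thesis by simp
qed

lemma char_poly_overlap_mat_level_coeff:
  assumes "finite V" "card V = n" "2 * s \<le> n" "t \<le> s" "distinct xs" "set xs = nsets V t"
  shows "char_poly (overlap_mat t (level_coeff n s \<kappa> t) xs) =
    (\<Prod>i\<le>t. [:- level_coeff n s \<kappa> i i, 1:] ^ ((n choose i) - binomial_pred n i))"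
  using assms(4-)
proof (induction t arbitrary: xs)
  case 0
  \<comment> \<open>The empty set is the only index at level 0, so the matrix is 1 by 1 and its
    entry has multiplicity \<open>n choose 0\<close>.\<close>
  then have "set xs = {{}}"
    by auto
  moreover from this have "length xs = Suc 0"
    using distinct_card[OF \<open>distinct xs\<close>] by simp
  then obtain S where "xs = [S]"
    by (auto simp: length_Suc_conv)
  ultimately have "xs = [{}]"
    by simp
  then have "overlap_mat 0 (level_coeff n s \<kappa> 0) xs = level_coeff n s \<kappa> 0 0 \<cdot>\<^sub>m 1\<^sub>m 1"
    by (auto simp: overlap_mat_def set_mat_def intro!: eq_matI)
  then show ?case
    by (simp only: char_poly_scalar_mat) (simp add: binomial_pred_def)
next
  case (Suc t)
  obtain ys where ys: "set ys = nsets V t" "distinct ys"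
    using finite_distinct_list[OF finite_imp_finite_nsets[OF assms(1)]] by blast
  have "level_coeff n s \<kappa> t j =
      level_coeff n s \<kappa> (Suc t) j * (real (card V) - real t - real j) / (real t + 1 - real j) +
      level_coeff n s \<kappa> (Suc t) (Suc j)" if "j \<le> t" for j
    using level_coeff_Suc[of t s n j \<kappa>] that Suc.prems(1) assms(2,3) by simp
  then have "char_poly (overlap_mat (Suc t) (level_coeff n s \<kappa> (Suc t)) xs) =
    [:- level_coeff n s \<kappa> (Suc t) (Suc t), 1:] ^ ((n choose Suc t) - (n choose t)) *
    char_poly (overlap_mat t (level_coeff n s \<kappa> t) ys)"
    using char_poly_overlap_mat_Suc[of V t xs ys "level_coeff n s \<kappa> t" "level_coeff n s \<kappa> (Suc t)"]
      Suc.prems assms(1-3) ys by simp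
  also have "char_poly (overlap_mat t (level_coeff n s \<kappa> t) ys) =
    (\<Prod>i\<le>t. [:- level_coeff n s \<kappa> i i, 1:] ^ ((n choose i) - binomial_pred n i))"
    using Suc.IH[of ys] Suc.prems ys by simp
  finally show ?case
    by (simp add: binomial_pred_def)
qed

section \<open>The Laplacian of the complete hypergraph as an overlap matrix\<close>

lemma set_degree_complete_hypergraph:
  assumes V: "finite V" and S: "S \<subseteq> V" "card S \<le> r"
  shows "set_degree (complete_hypergraph_edges r V) S = (card V - card S) choose (r - card S)"
proof -
  have fS: "finite S"
    using assms finite_subset by blast
  have "bij_betw (\<lambda>e. e \<union> S) (nsets (V - S) (r - card S)) {e \<in> nsets V r. S \<subseteq> e}"
  proof (rule bij_betw_byWitness[where f' = "\<lambda>e. e - S"])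
    show "(\<lambda>e. e \<union> S) ` nsets (V - S) (r - card S) \<subseteq> {e \<in> nsets V r. S \<subseteq> e}"
    proof (intro subsetI, elim imageE)
      fix e d assume "d \<in> nsets (V - S) (r - card S)" and e: "e = d \<union> S"
      then have "d \<subseteq> V - S" "finite d" "card d = r - card S" by (auto simp: nsets_def)
      moreover from this have "card (d \<union> S) = card d + card S"
        using fS by (intro card_Un_disjoint) auto
      ultimately show "e \<in> {e \<in> nsets V r. S \<subseteq> e}"
        using S fS unfolding e nsets_def by auto
    qed
  qed (use fS in \<open>auto simp: nsets_def card_Diff_subset\<close>)
  then have "card {e \<in> nsets V r. S \<subseteq> e} = card (nsets (V - S) (r - card S))"
    by (rule bij_betw_same_card[symmetric])
  then show ?thesis
    using assms fS by (simp add: set_degree_def complete_hypergraph_edges_def card_nsets card_Diff_subset)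
qed

text \<open>All \<open>s\<close>-sets have equal degree and all disjoint pairs equal weight, so
  normalization only divides the disjointness matrix by \<open>(n - s) choose s\<close>; the
  dependence on \<open>r\<close> cancels.\<close>

lemma hypergraph_laplacian_complete:
  assumes V: "finite V" "card V = n" and s: "2 * s \<le> r" "r \<le> n"
    and xs: "distinct xs" "set xs = nsets V s"
  shows "hypergraph_laplacian r s (complete_hypergraph_edges r V) xs =
    overlap_mat s (level_coeff n s (1 / real ((n - s) choose s)) s) xs"
proof -
  let ?E = "complete_hypergraph_edges r V"
  define d where "d = real ((r - s) choose s) * real ((n - s) choose (r - s))"
  define w where "w = real ((n - 2 * s) choose (r - 2 * s))"
  have w: "w > 0" and ns: "real ((n - s) choose s) > 0"
    using s by (auto simp: w_def)
  have d: "d = w * real ((n - s) choose s)"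
  proof -
    \<comment> \<open>Both sides count pairs of an \<open>(r - s)\<close>-set and an
      \<open>s\<close>-subset of it inside an \<open>(n - s)\<close>-set.\<close>
    have "((n - s) choose (r - s)) * ((r - s) choose s) = ((n - s) choose s) * ((n - s - s) choose (r - s - s))"
      using s by (intro choose_mult) auto
    then show ?thesis
      unfolding d_def w_def by (metis diff_diff_left mult.commute mult_2 of_nat_mult)
  qed
  have deg: "set_degree ?E S = (n - s) choose (r - s)" if "S \<in> set xs" for S
    using that xs V s by (subst set_degree_complete_hypergraph) (auto simp: nsets_def)
  have T: "diag_inv_sqrt (aux_degree_mat r s ?E xs) = mat_diag (length xs) (\<lambda>i. 1 / sqrt d)"
    by (rule eq_matI) (auto simp: diag_inv_sqrt_def aux_degree_mat_def set_degree_mat_def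
        mat_diag_def deg d_def)
  have weight: "real (set_weight ?E S U) = w * (\<Sum>j\<le>s. (- 1) ^ j * real (card (S \<inter> U) choose j))"
    if "S \<in> set xs" "U \<in> set xs" for S U
  proof -
    have SU: "S \<subseteq> V" "U \<subseteq> V" "card S = s" "card U = s" "finite S" "finite U"
      using that xs by (auto simp: nsets_def)
    then have "card (S \<inter> U) \<le> s"
      by (metis card_mono inf_le1)
    \<comment> \<open>Terms beyond the overlap size vanish, leaving the full alternating row sum,
      which is 1 for empty overlap and 0 otherwise.\<close>
    then have "(\<Sum>j\<le>s. (- 1) ^ j * real (card (S \<inter> U) choose j)) =
        (\<Sum>j\<le>card (S \<inter> U). (- 1) ^ j * real (card (S \<inter> U) choose j))"
      by (intro sum.mono_neutral_right) auto
    also have "\<dots> = of_bool (S \<inter> U = {})"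
      using choose_alternating_sum[of "card (S \<inter> U)", where 'a = real] SU
      by (cases "S \<inter> U = {}") (auto simp: card_gt_0_iff)
    finally have alt: "(\<Sum>j\<le>s. (- 1) ^ j * real (card (S \<inter> U) choose j)) = of_bool (S \<inter> U = {})" .
    show ?thesis
    proof (cases "S \<inter> U = {}")
      case True
      then have "card (S \<union> U) = 2 * s"
        using SU by (simp add: card_Un_disjoint)
      then show ?thesis
        unfolding alt using True SU V s
        by (simp add: set_weight_def set_degree_complete_hypergraph w_def)
    qed (simp add: alt set_weight_def)
  qed
  have "hypergraph_laplacian r s ?E xs =
      1\<^sub>m (length xs) - mat (length xs) (length xs) (\<lambda>(i, j). real (set_weight ?E (xs ! i) (xs ! j)) / d)"
    unfolding hypergraph_laplacian_def T weight_mat_def using d w ns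
    by (subst mat_diag_mult_left[where nr = "length xs"], simp,
        subst mat_diag_mult_right[where nr = "length xs"], simp)
      (auto intro!: eq_matI simp: field_simps)
  also have "\<dots> = set_mat xs xs (\<lambda>S U. of_bool (S = U) - real (set_weight ?E S U) / d)"
    unfolding set_mat_def by (rule eq_matI) (auto simp: nth_eq_iff_index_eq[OF xs(1)])
  also have "\<dots> = overlap_mat s (level_coeff n s (1 / real ((n - s) choose s)) s) xs"
    unfolding overlap_mat_def
  proof (rule set_mat_cong)
    fix S U assume SU: "S \<in> set xs" "U \<in> set xs"
    \<comment> \<open>At level \<open>s\<close> both binomials in \<open>level_coeff\<close> have
      lower index 0 and equal 1.\<close>
    have "(\<Sum>j\<le>s. level_coeff n s (1 / real ((n - s) choose s)) s j * real (card (S \<inter> U) choose j)) =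
      (\<Sum>j\<le>s. of_bool (j = s) * real (card (S \<inter> U) choose j)) -
      (\<Sum>j\<le>s. (- 1) ^ j * real (card (S \<inter> U) choose j)) / real ((n - s) choose s)"
      unfolding sum_divide_distrib sum_subtractf[symmetric]
      by (intro sum.cong refl) (simp add: level_coeff_def algebra_simps)
    also have "(\<Sum>j\<le>s. of_bool (j = s) * real (card (S \<inter> U) choose j)) = of_bool (S = U)"
      using choose_card_Int_eq_of_bool[of S V s U] SU xs
      by (simp add: Int_absorb1)
    also have "(\<Sum>j\<le>s. (- 1) ^ j * real (card (S \<inter> U) choose j)) / real ((n - s) choose s) =
        real (set_weight ?E S U) / d"
      using w by (simp add: weight[OF SU] d)
    finally show "of_bool (S = U) - real (set_weight ?E S U) / d =
      (\<Sum>j\<le>s. level_coeff n s (1 / real ((n - s) choose s)) s j * real (card (S \<inter> U) choose j))"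
      by simp
  qed
  finally show ?thesis .
qed

theorem theorem1:
  fixes V :: "'a set" and n r s :: nat and xs :: "'a set list"
  assumes "finite V" and "card V = n"
    and "1 \<le> s" and "real s \<le> real r / 2"
    and "2 * s \<le> n" and "r \<le> n"
    and "distinct xs" and "set xs = nsets V s"
  shows "eigenvalues_mset (hypergraph_laplacian r s (complete_hypergraph_edges r V) xs) =
    (\<Sum>i\<in>{0..s}. replicate_mset ((n choose i) - binomial_pred n i)
       (1 - (- 1) ^ i * real ((n - s - i) choose (s - i)) / real ((n - s) choose s)))"
proof -
  let ?c = "level_coeff n s (1 / real ((n - s) choose s))"
  have "2 * s \<le> r"
    using assms(4) by linarith
  then have "char_poly (hypergraph_laplacian r s (complete_hypergraph_edges r V) xs) =
      (\<Prod>i\<le>s. [:- ?c i i, 1:] ^ ((n choose i) - binomial_pred n i))"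
    using assms by (simp add: hypergraph_laplacian_complete char_poly_overlap_mat_level_coeff)
  then have "eigenvalues_mset (hypergraph_laplacian r s (complete_hypergraph_edges r V) xs) =
      (\<Sum>i\<le>s. replicate_mset ((n choose i) - binomial_pred n i) (?c i i))"
    by (simp add: eigenvalues_mset_def proots_prod proots_power)
  \<comment> \<open>On the diagonal the denominator of \<open>level_coeff\<close> is
    \<open>(s - i) choose (s - i)\<close>, which is 1.\<close>
  also have "\<dots> = (\<Sum>i\<in>{0..s}. replicate_mset ((n choose i) - binomial_pred n i)
       (1 - (- 1) ^ i * real ((n - s - i) choose (s - i)) / real ((n - s) choose s)))"
    by (intro sum.cong) (auto simp: level_coeff_def)
  finally show ?thesis .
qed

end
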